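(* Let $a_1,a_2,b_1,b_2>0$ and put $a=a_1+a_2$, $b=b_1+b_2$. For all integers $n_1,n_2\ge 0$, the following addition formula for the multiple Charlier polynomials is valid: $$C_{n_1,n_2}^{(a,b)}(x+y)=\sum_{k=0}^{n_1}\sum_{\ell=0}^{n_2}\binom{n_1}{k}\binom{n_2}{\ell}\, C^{(a_1,b_1)}_{k,\ell}(x)\,C^{(a_2,b_2)}_{n_1-k,n_2-\ell}(y).$$
   Context: For an integer $n\ge 0$, $x^{(n,1)}=x(x-1)\cdots(x-n+1)$ denotes the falling factorial, with $x^{(0,1)}=1$. For parameters $\alpha,\beta>0$ and integers $n_1,n_2\ge 0$, the multiple Charlier polynomials (for the two weights $\alpha^x/\Gamma(x+1)$ and $\beta^x/\Gamma(x+1)$, $x=0,1,2,\ldots$) are given by $$C_{n_1,n_2}^{(\alpha,\beta)}(x)=\sum_{k=0}^{n_1}\sum_{\ell=0}^{n_2}\binom{n_1}{k}\binom{n_2}{\ell}(-\alpha)^{n_1-k}(-\beta)^{n_2-\ell}\,x^{(k+\ell,1)}.$$ *)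

theory Defs
  imports Complex_Main
begin

definition falling_factorial :: "'a::comm_ring_1 \<Rightarrow> nat \<Rightarrow> 'a" where
  "falling_factorial x n = (\<Prod>i<n. x - of_nat i)"

text \<open>
  The parameters of the weights are real; the variable of the polynomial may be taken in any
  field extension of the reals, in particular in \<^typ>\<open>real\<close> or \<^typ>\<open>complex\<close>.
\<close>

definition multiple_charlier ::
    "real \<Rightarrow> real \<Rightarrow> nat \<Rightarrow> nat \<Rightarrow> 'a::real_field \<Rightarrow> 'a" where
  "multiple_charlier \<alpha> \<beta> n\<^sub>1 n\<^sub>2 x =
     (\<Sum>k=0..n\<^sub>1. \<Sum>l=0..n\<^sub>2.
        of_nat (n\<^sub>1 choose k) * of_nat (n\<^sub>2 choose l)
          * of_real ((-\<alpha>) ^ (n\<^sub>1 - k) * (-\<beta>) ^ (n\<^sub>2 - l))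
          * falling_factorial x (k + l))"

end

theory Submission
  imports Defs
begin

text \<open>
  Pascal's rule gives the raising relation
  \<open>C (m + 1) n x = x * C m n (x - 1) - \<alpha> * C m n x\<close>. By Pascal's rule again, raising \<open>m\<close> on the
  right-hand side of the addition formula has the effect that the raising relation prescribes for
  the left-hand side, because \<open>x, y\<close> and \<open>a\<^sub>1, a\<^sub>2\<close> enter additively. The two indices play
  symmetric roles, so the formula follows by induction on each of them.
\<close>

lemma falling_factorial_0 [simp]: "falling_factorial x 0 = 1"
  by (simp add: falling_factorial_def)

lemma falling_factorial_Suc: "falling_factorial x (Suc n) = x * falling_factorial (x - 1) n"
  by (simp add: falling_factorial_def prod.lessThan_Suc_shift diff_diff_eq del: prod.lessThan_Suc)

text \<open>Pascal's rule under a sum. The complementary index is a separate argument of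
  \<open>f\<close>, so that the two halves of the rule raise one argument each.\<close>

lemma sum_choose_Suc:
  fixes f :: "nat \<Rightarrow> nat \<Rightarrow> 'a::comm_semiring_1"
  shows "(\<Sum>k=0..Suc n. of_nat (Suc n choose k) * f k (Suc n - k)) =
    (\<Sum>k=0..n. of_nat (n choose k) * (f (Suc k) (n - k) + f k (Suc (n - k))))"
proof -
  have "(\<Sum>k=0..n. of_nat (n choose Suc k) * f (Suc k) (n - k)) + f 0 (Suc n) =
      (\<Sum>k=0..Suc n. of_nat (n choose k) * f k (Suc n - k))"
    by (simp only: sum.atLeast0_atMost_Suc_shift) (simp add: add.commute)
  \<comment> \<open>The top term drops out because \<open>n choose Suc n\<close> is 0.\<close>
  also have "\<dots> = (\<Sum>k=0..n. of_nat (n choose k) * f k (Suc (n - k)))"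
    by (simp add: Suc_diff_le binomial_eq_0)
  finally have "(\<Sum>k=0..n. of_nat (n choose k) * f k (Suc (n - k))) =
      (\<Sum>k=0..n. of_nat (n choose Suc k) * f (Suc k) (n - k)) + f 0 (Suc n)" ..
  then show ?thesis
    by (subst sum.atLeast0_atMost_Suc_shift) (simp add: distrib_left distrib_right sum.distrib ac_simps)
qed

lemma multiple_charlier_0_0 [simp]: "multiple_charlier \<alpha> \<beta> 0 0 x = 1"
  by (simp add: multiple_charlier_def)

lemma multiple_charlier_swap: "multiple_charlier \<alpha> \<beta> m n x = multiple_charlier \<beta> \<alpha> n m x"
  unfolding multiple_charlier_def by (subst sum.swap) (simp add: ac_simps)

text \<open>Raising the order of the falling factorial pulls out \<open>x\<close> and shifts the
  variable to \<open>x - 1\<close>; raising the exponent pulls out -\<alpha>. Pascal's rule adds the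
  two effects.\<close>

lemma multiple_charlier_Suc:
  "multiple_charlier \<alpha> \<beta> (Suc m) n x =
     x * multiple_charlier \<alpha> \<beta> m n (x - 1) - of_real \<alpha> * multiple_charlier \<alpha> \<beta> m n x"
proof -
  \<comment> \<open>The exponent \<open>j\<close> is decoupled from \<open>m - k\<close> to match
    the shape of \<open>sum_choose_Suc\<close>; \<open>g\<close> is the same sum at
    \<open>x - 1\<close>.\<close>
  define f where "f k j = (\<Sum>l=0..n. of_nat (n choose l)
      * of_real ((-\<alpha>) ^ j * (-\<beta>) ^ (n - l)) * falling_factorial x (k + l))" for k j
  define g where "g k j = (\<Sum>l=0..n. of_nat (n choose l)
      * of_real ((-\<alpha>) ^ j * (-\<beta>) ^ (n - l)) * falling_factorial (x - 1) (k + l))" for k j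
  have C: "multiple_charlier \<alpha> \<beta> i n x = (\<Sum>k=0..i. of_nat (i choose k) * f k (i - k))" for i
    by (simp add: multiple_charlier_def f_def sum_distrib_left mult.assoc)
  have C': "multiple_charlier \<alpha> \<beta> m n (x - 1) = (\<Sum>k=0..m. of_nat (m choose k) * g k (m - k))"
    by (simp add: multiple_charlier_def g_def sum_distrib_left mult.assoc)
  have f_Suc: "f (Suc k) j = x * g k j" for k j
    by (simp add: f_def g_def falling_factorial_Suc sum_distrib_left mult_ac)
  have f_Suc': "f k (Suc j) = - of_real \<alpha> * f k j" for k j
    by (simp add: f_def sum_distrib_left mult_ac flip: sum_negf)
  show ?thesis
    unfolding C C' sum_choose_Suc f_Suc f_Suc'
    by (simp add: sum_distrib_left sum_subtractf algebra_simps)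
qed

text \<open>In terms of exponential generating functions in both indices, this is a product.\<close>

definition charlier_convolution ::
    "real \<Rightarrow> real \<Rightarrow> real \<Rightarrow> real \<Rightarrow> nat \<Rightarrow> nat \<Rightarrow> 'a::real_field \<Rightarrow> 'a \<Rightarrow> 'a" where
  "charlier_convolution \<alpha> \<beta> \<gamma> \<delta> m n x y =
    (\<Sum>k=0..m. \<Sum>l=0..n. of_nat (m choose k) * of_nat (n choose l)
       * multiple_charlier \<alpha> \<beta> k l x * multiple_charlier \<gamma> \<delta> (m - k) (n - l) y)"

lemma charlier_convolution_swap:
  "charlier_convolution \<alpha> \<beta> \<gamma> \<delta> m n x y = charlier_convolution \<beta> \<alpha> \<delta> \<gamma> n m x y"
  unfolding charlier_convolution_def
  by (subst sum.swap) (simp add: multiple_charlier_swap[of \<alpha> \<beta>] multiple_charlier_swap[of \<gamma> \<delta>] mult_ac)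

text \<open>A Leibniz rule: Pascal's rule raises either the factor in \<open>x\<close> or the factor
  in \<open>y\<close>, and \<open>multiple_charlier_Suc\<close> expands whichever is raised.\<close>

lemma charlier_convolution_Suc:
  "charlier_convolution \<alpha> \<beta> \<gamma> \<delta> (Suc m) n x y =
     x * charlier_convolution \<alpha> \<beta> \<gamma> \<delta> m n (x - 1) y
     + y * charlier_convolution \<alpha> \<beta> \<gamma> \<delta> m n x (y - 1)
     - of_real (\<alpha> + \<gamma>) * charlier_convolution \<alpha> \<beta> \<gamma> \<delta> m n x y"
proof -
  define f where "f x y k j = (\<Sum>l=0..n. of_nat (n choose l)
      * multiple_charlier \<alpha> \<beta> k l x * multiple_charlier \<gamma> \<delta> j (n - l) y)" for x y :: 'a and k j
  have S: "charlier_convolution \<alpha> \<beta> \<gamma> \<delta> i n x y = (\<Sum>k=0..i. of_nat (i choose k) * f x y k (i - k))"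
    for i x y
    by (simp add: charlier_convolution_def f_def sum_distrib_left mult.assoc)
  have f_Suc: "f x y (Suc k) j = x * f (x - 1) y k j - of_real \<alpha> * f x y k j" for k j
    by (simp add: f_def multiple_charlier_Suc sum_distrib_left algebra_simps flip: sum_subtractf)
  have f_Suc': "f x y k (Suc j) = y * f x (y - 1) k j - of_real \<gamma> * f x y k j" for k j
    by (simp add: f_def multiple_charlier_Suc sum_distrib_left algebra_simps flip: sum_subtractf)
  show ?thesis
    unfolding S sum_choose_Suc f_Suc f_Suc'
    by (simp add: sum_distrib_left sum.distrib sum_subtractf algebra_simps)
qed

text \<open>The assumption is used at \<open>(x - 1, y)\<close>, \<open>(x, y - 1)\<close> and
  \<open>(x, y)\<close>, hence the quantification. The first two pairs have the same sum
  \<open>x + y - 1\<close>, so their terms merge with coefficient \<open>x + y\<close>.\<close>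

lemma multiple_charlier_add_Suc:
  assumes "\<And>x y :: 'a::real_field.
      multiple_charlier (\<alpha> + \<gamma>) (\<beta> + \<delta>) m n (x + y) = charlier_convolution \<alpha> \<beta> \<gamma> \<delta> m n x y"
  shows "multiple_charlier (\<alpha> + \<gamma>) (\<beta> + \<delta>) (Suc m) n (x + y :: 'a) =
      charlier_convolution \<alpha> \<beta> \<gamma> \<delta> (Suc m) n x y"
  by (simp add: charlier_convolution_Suc multiple_charlier_Suc algebra_simps flip: assms)

lemma multiple_charlier_add:
  "multiple_charlier (\<alpha> + \<gamma>) (\<beta> + \<delta>) m n (x + y) = charlier_convolution \<alpha> \<beta> \<gamma> \<delta> m n x y"
proof (induction m arbitrary: x y)
  case 0
  \<comment> \<open>Swapping the roles of the indices puts \<open>n\<close> first, where the same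
    induction step applies.\<close>
  have "multiple_charlier (\<beta> + \<delta>) (\<alpha> + \<gamma>) n 0 (x + y) = charlier_convolution \<beta> \<alpha> \<delta> \<gamma> n 0 x y" for x y :: 'a
  proof (induction n arbitrary: x y)
    case 0
    show ?case by (simp add: charlier_convolution_def)
  qed (rule multiple_charlier_add_Suc)
  then show ?case
    by (subst multiple_charlier_swap, subst charlier_convolution_swap)
qed (rule multiple_charlier_add_Suc)

theorem theorem5:
  fixes a\<^sub>1 a\<^sub>2 b\<^sub>1 b\<^sub>2 a b :: real
    and n\<^sub>1 n\<^sub>2 :: nat
    and x y :: "'a::real_field"
  assumes "a\<^sub>1 > 0" and "a\<^sub>2 > 0" and "b\<^sub>1 > 0" and "b\<^sub>2 > 0"
    and "a = a\<^sub>1 + a\<^sub>2" and "b = b\<^sub>1 + b\<^sub>2"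
  shows "multiple_charlier a b n\<^sub>1 n\<^sub>2 (x + y) =
    (\<Sum>k=0..n\<^sub>1. \<Sum>l=0..n\<^sub>2.
       of_nat (n\<^sub>1 choose k) * of_nat (n\<^sub>2 choose l)
         * multiple_charlier a\<^sub>1 b\<^sub>1 k l x
         * multiple_charlier a\<^sub>2 b\<^sub>2 (n\<^sub>1 - k) (n\<^sub>2 - l) y)"
  unfolding \<open>a = a\<^sub>1 + a\<^sub>2\<close> \<open>b = b\<^sub>1 + b\<^sub>2\<close>
  by (simp only: multiple_charlier_add charlier_convolution_def)

end
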